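(* Let $\lambda$ be a partition. Then \[\mathcal Hs_\lambda(X,Y)=\sum_{\tau\in S_{\ell(\lambda)}}\mathrm{sign}(\tau)\,\mathcal H\mathfrak S^*_{\tau(\lambda)}(X,Y).\]
   Context: Let $X=(x_1,\dots,x_\ell)$, $Y=(y_1,\dots,y_k)$. The hook Schur function is $\mathcal Hs_\lambda(X,Y)=\sum_{\mu\subseteq\lambda}s_\mu(X)\,s_{\lambda'/\mu'}(Y)$ (sum over partitions $\mu$, $'$ denoting conjugation). For a partition $\lambda$ with $m$ parts and $\tau\in S_m$, $\tau(\lambda)=(\lambda_{\tau_1}+1-\tau_1,\dots,\lambda_{\tau_m}+m-\tau_m)$, defined only when all entries are positive; terms with $\tau(\lambda)$ undefined are $0$. Let $\mathcal A=\{1,\dots,\ell\}$, $\mathcal A'=\{1',\dots,k'\}$ with order $1<\dots<\ell<1'<\dots<k'$, $z_i=x_i$, $z_{i'}=y_i$. A semistandard hook immaculate tableau of shape $\alpha$ (a composition; diagram with $\alpha_i$ left-justified boxes in row $i$, row 1 at bottom) is a filling with entries in $\mathcal A\cup\mathcal A'$ such that the first column increases bottom to top, strictly for entries in $\mathcal A$ and weakly for entries in $\mathcal A'$, and each row increases left to right, weakly for entries in $\mathcal A$ and strictly for entries in $\mathcal A'$. $\mathcal H\mathfrak S^*_\alpha(X,Y)=\sum_T\prod_az_a^{\#\{a\text{'s in }T\}}$ over all such tableaux $T$ of shape $\alpha$. *)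

theory Defs
  imports
    "HOL-Library.FuncSet"
    "HOL-Library.Poly_Mapping"
    "HOL-Combinatorics.Permutations"
begin

section \<open>Partitions, compositions, diagrams\<close>

text \<open>
  Partitions and compositions are lists of positive parts, so \<open>length\<close> is the number of parts.
  Rows and columns of a diagram are numbered from 0, and row 0 is the bottom row (French
  convention); a cell is a pair of a row and a column.
\<close>

definition is_partition :: "nat list \<Rightarrow> bool" where
  "is_partition p \<longleftrightarrow> sorted_wrt (\<ge>) p \<and> (\<forall>a \<in> set p. 0 < a)"

definition diagram :: "nat list \<Rightarrow> (nat \<times> nat) set" where
  "diagram p = {(i, j). i < length p \<and> j < p ! i}"

definition conjugate :: "nat list \<Rightarrow> nat list" where
  "conjugate p = map (\<lambda>j. card {i. i < length p \<and> j < p ! i}) [0..<foldr max p 0]"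

definition subpartitions :: "nat list \<Rightarrow> nat list set" where
  "subpartitions p = {q. is_partition q \<and> diagram q \<subseteq> diagram p}"

lemma finite_diagram: "finite (diagram p)"
proof -
  have "diagram p = Sigma {..<length p} (\<lambda>i. {..<p ! i})"
    by (auto simp: diagram_def)
  then show ?thesis by simp
qed

lemma finite_subpartitions: "finite (subpartitions p)"
proof (rule finite_subset)
  show "subpartitions p \<subseteq> {q. set q \<subseteq> {..foldr max p 0} \<and> length q \<le> length p}"
  proof
    fix q assume q: "q \<in> subpartitions p"
    have le: "a \<le> foldr max p 0" if "a \<in> set p" for a
      using that by (induction p) auto
    have row: "i < length p \<and> q ! i \<le> p ! i" if "i < length q" for i
    proof -
      have "0 < q ! i" using q that by (auto simp: subpartitions_def is_partition_def)
      then have "(i, q ! i - 1) \<in> diagram q" using that by (simp add: diagram_def)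
      then have "(i, q ! i - 1) \<in> diagram p" using q by (auto simp: subpartitions_def)
      then show ?thesis by (auto simp: diagram_def)
    qed
    have "length q \<le> length p" using row by (meson leI less_irrefl)
    moreover have "a \<le> foldr max p 0" if "a \<in> set q" for a
      using that row le by (metis in_set_conv_nth nth_mem le_trans)
    ultimately show "q \<in> {q. set q \<subseteq> {..foldr max p 0} \<and> length q \<le> length p}" by auto
  qed
  show "finite {q. set q \<subseteq> {..foldr max p 0} \<and> length q \<le> length p}"
    by (rule finite_lists_length_le) simp
qed


section \<open>The polynomial ring\<close>

text \<open>\<open>Unprimed i\<close> stands for \<open>i\<close> and \<open>Primed i\<close> for \<open>i'\<close>.\<close>

datatype letter = Unprimed nat | Primed nat

text \<open>Integer polynomials in commuting indeterminates indexed by letters: the inner mapping is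
  the exponent vector of a monomial, the outer one gives its coefficient.\<close>

type_synonym letter_poly = "(letter \<Rightarrow>\<^sub>0 nat) \<Rightarrow>\<^sub>0 int"

definition z_var :: "letter \<Rightarrow> letter_poly" where
  "z_var a = Poly_Mapping.single (Poly_Mapping.single a 1) 1"

definition x_var :: "nat \<Rightarrow> letter_poly" where
  "x_var i = z_var (Unprimed i)"

definition y_var :: "nat \<Rightarrow> letter_poly" where
  "y_var i = z_var (Primed i)"


section \<open>Skew Schur and hook Schur polynomials\<close>

text \<open>Fillings are extensional functions on the set of cells, so each filling is counted once.\<close>

definition skew_ssyt :: "nat \<Rightarrow> nat list \<Rightarrow> nat list \<Rightarrow> (nat \<times> nat \<Rightarrow> nat) set" where
  "skew_ssyt n p q =
     {T \<in> (diagram p - diagram q) \<rightarrow>\<^sub>E {1..n}.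
        (\<forall>i j j'. (i, j) \<in> diagram p - diagram q \<and> (i, j') \<in> diagram p - diagram q \<and> j < j'
            \<longrightarrow> T (i, j) \<le> T (i, j')) \<and>
        (\<forall>i i' j. (i, j) \<in> diagram p - diagram q \<and> (i', j) \<in> diagram p - diagram q \<and> i < i'
            \<longrightarrow> T (i, j) < T (i', j))}"

definition skew_schur ::
    "nat \<Rightarrow> (nat \<Rightarrow> letter_poly) \<Rightarrow> nat list \<Rightarrow> nat list \<Rightarrow> letter_poly" where
  "skew_schur n v p q =
     (\<Sum>T \<in> skew_ssyt n p q. \<Prod>a \<in> {1..n}. v a ^ card {c \<in> diagram p - diagram q. T c = a})"

definition schur :: "nat \<Rightarrow> (nat \<Rightarrow> letter_poly) \<Rightarrow> nat list \<Rightarrow> letter_poly" where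
  "schur n v p = skew_schur n v p []"

text \<open>Here \<open>l\<close> and \<open>k\<close> are the numbers of \<open>x\<close>- and \<open>y\<close>-variables.\<close>

definition hook_schur :: "nat \<Rightarrow> nat \<Rightarrow> nat list \<Rightarrow> letter_poly" where
  "hook_schur l k p =
     (\<Sum>q \<in> subpartitions p.
        schur l x_var q * skew_schur k y_var (conjugate p) (conjugate q))"


section \<open>Hook dual immaculate polynomials\<close>

fun letter_less :: "letter \<Rightarrow> letter \<Rightarrow> bool" where
  "letter_less (Unprimed i) (Unprimed j) \<longleftrightarrow> i < j"
| "letter_less (Unprimed i) (Primed j) \<longleftrightarrow> True"
| "letter_less (Primed i) (Unprimed j) \<longleftrightarrow> False"
| "letter_less (Primed i) (Primed j) \<longleftrightarrow> i < j"

definition letters :: "nat \<Rightarrow> nat \<Rightarrow> letter set" where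
  "letters l k = Unprimed ` {1..l} \<union> Primed ` {1..k}"

text \<open>Equal entries are allowed only if unprimed (in rows), respectively primed (in the first
  column).\<close>

definition row_incr :: "letter \<Rightarrow> letter \<Rightarrow> bool" where
  "row_incr a b \<longleftrightarrow> letter_less a b \<or> (a = b \<and> a \<in> range Unprimed)"

definition col_incr :: "letter \<Rightarrow> letter \<Rightarrow> bool" where
  "col_incr a b \<longleftrightarrow> letter_less a b \<or> (a = b \<and> a \<in> range Primed)"

definition hook_immaculate_tableaux ::
    "nat \<Rightarrow> nat \<Rightarrow> nat list \<Rightarrow> (nat \<times> nat \<Rightarrow> letter) set" where
  "hook_immaculate_tableaux l k \<alpha> =
     {T \<in> diagram \<alpha> \<rightarrow>\<^sub>E letters l k.
        (\<forall>i i'. (i, 0) \<in> diagram \<alpha> \<and> (i', 0) \<in> diagram \<alpha> \<and> i < i'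
            \<longrightarrow> col_incr (T (i, 0)) (T (i', 0))) \<and>
        (\<forall>i j j'. (i, j) \<in> diagram \<alpha> \<and> (i, j') \<in> diagram \<alpha> \<and> j < j'
            \<longrightarrow> row_incr (T (i, j)) (T (i, j')))}"

definition hook_dual_immaculate :: "nat \<Rightarrow> nat \<Rightarrow> nat list \<Rightarrow> letter_poly" where
  "hook_dual_immaculate l k \<alpha> =
     (\<Sum>T \<in> hook_immaculate_tableaux l k \<alpha>.
        \<Prod>a \<in> letters l k. z_var a ^ card {c \<in> diagram \<alpha>. T c = a})"


section \<open>The action of permutations on partitions\<close>

text \<open>
  Permutations act on the indices \<open>{..<m}\<close> instead of \<open>{1..m}\<close>; the entry
  \<open>\<lambda>\<^bsub>\<tau> i\<^esub> + i - \<tau> i\<close> is unaffected by this shift.  It is computed in the integers, and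
  \<open>None\<close> means that \<open>\<tau>(\<lambda>)\<close> is undefined.
\<close>

definition perm_entries :: "(nat \<Rightarrow> nat) \<Rightarrow> nat list \<Rightarrow> int list" where
  "perm_entries \<tau> p = map (\<lambda>i. int (p ! \<tau> i) + int i - int (\<tau> i)) [0..<length p]"

definition perm_shape :: "(nat \<Rightarrow> nat) \<Rightarrow> nat list \<Rightarrow> nat list option" where
  "perm_shape \<tau> p =
     (if \<forall>e \<in> set (perm_entries \<tau> p). 0 < e then Some (map nat (perm_entries \<tau> p)) else None)"

definition hook_dual_immaculate_opt :: "nat \<Rightarrow> nat \<Rightarrow> nat list option \<Rightarrow> letter_poly" where
  "hook_dual_immaculate_opt l k s =
     (case s of None \<Rightarrow> 0 | Some \<alpha> \<Rightarrow> hook_dual_immaculate l k \<alpha>)"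

end

theory Submission
  imports Defs
begin

text \<open>
  On the right-hand side, a pair of a permutation and a filling whose first column increases but
  which has a descent in some other column is cancelled by exchanging the tails of two adjacent
  rows at that descent. As the descent is never in column 0, the exchange leaves the first column
  untouched. A filling without descents has weakly decreasing row lengths, which forces the
  permutation to be the identity, so the survivors are the \<open>(l, k)\<close>-semistandard fillings of the
  partition. Their unprimed cells form a subpartition, and splitting the filling along it gives
  the product of a Schur and a conjugated skew Schur polynomial.
\<close>

section \<open>Comparison of letters along rows and columns\<close>

lemma row_incr_trans: "row_incr a b \<Longrightarrow> row_incr b c \<Longrightarrow> row_incr a c"
  by (cases a; cases b; cases c) (auto simp: row_incr_def)

lemma col_incr_trans: "col_incr a b \<Longrightarrow> col_incr b c \<Longrightarrow> col_incr a c"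
  by (cases a; cases b; cases c) (auto simp: col_incr_def)

text \<open>Letters are totally ordered, and equality of a letter with itself counts for exactly one
  of the two relations: for rows if unprimed, for columns if primed. This is what turns a column
  descent into a legal row step.\<close>

lemma not_col_incr_iff: "\<not> col_incr a b \<longleftrightarrow> row_incr b a"
  by (cases a; cases b) (auto simp: col_incr_def row_incr_def)

text \<open>The two steps cannot both be equalities, as \<open>b\<close> would be primed and
  unprimed at once; so \<open>a\<close> is strictly below \<open>c\<close>.\<close>

lemma col_row_incr_trans: "col_incr a b \<Longrightarrow> row_incr b c \<Longrightarrow> row_incr a c"
  by (cases a; cases b; cases c) (auto simp: row_incr_def col_incr_def)

text \<open>Monomials become products over cells, so that a bijection of cells can be applied by
  reindexing.\<close>

lemma prod_power_card_fibre:
  fixes v :: "'a \<Rightarrow> 'b::comm_monoid_mult"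
  assumes "finite A" "finite D" "T ` D \<subseteq> A"
  shows "(\<Prod>a\<in>A. v a ^ card {c \<in> D. T c = a}) = (\<Prod>c\<in>D. v (T c))"
proof -
  have "(\<Prod>a\<in>A. v a ^ card {c \<in> D. T c = a}) = (\<Prod>a\<in>A. \<Prod>c | c \<in> D \<and> T c = a. v (T c))"
    by (intro prod.cong) auto
  also have "\<dots> = (\<Prod>c\<in>D. v (T c))"
    using assms prod.group[of D A T "\<lambda>c. v (T c)"] by auto
  finally show ?thesis .
qed


section \<open>The sign-reversing involution\<close>

text \<open>Row lengths form a function instead of a list, so that changing two of them is a
  function update.\<close>

definition rows :: "nat \<Rightarrow> (nat \<Rightarrow> nat) \<Rightarrow> (nat \<times> nat) set" where
  "rows m s = {(i, j). i < m \<and> j < s i}"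

lemma mem_rows: "(i, j) \<in> rows m s \<longleftrightarrow> i < m \<and> j < s i"
  by (simp add: rows_def)

lemma diagram_eq_rows: "diagram p = rows (length p) (nth p)"
  by (simp add: diagram_def rows_def)

lemma finite_rows: "finite (rows m s)"
proof -
  have "rows m s = Sigma {..<m} (\<lambda>i. {..<s i})"
    by (auto simp: rows_def)
  then show ?thesis by simp
qed

definition imm_fillings :: "letter set \<Rightarrow> (nat \<times> nat) set \<Rightarrow> (nat \<times> nat \<Rightarrow> letter) set" where
  "imm_fillings A D =
     {T \<in> D \<rightarrow>\<^sub>E A.
        (\<forall>i i'. (i, 0) \<in> D \<and> (i', 0) \<in> D \<and> i < i' \<longrightarrow> col_incr (T (i, 0)) (T (i', 0))) \<and>
        (\<forall>i j j'. (i, j) \<in> D \<and> (i, j') \<in> D \<and> j < j' \<longrightarrow> row_incr (T (i, j)) (T (i, j')))}"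

text \<open>A missing cell below also counts as a descent; through this clause the absence of
  violations controls row lengths as well as entries.\<close>

definition violation :: "(nat \<times> nat) set \<Rightarrow> (nat \<times> nat \<Rightarrow> letter) \<Rightarrow> nat \<Rightarrow> nat \<Rightarrow> bool" where
  "violation D T i j \<longleftrightarrow>
     (Suc i, j) \<in> D \<and> ((i, j) \<in> D \<longrightarrow> \<not> col_incr (T (i, j)) (T (Suc i, j)))"

text \<open>Leftmost column first, then topmost row: exactly this choice is unaffected by the tail
  exchange, which changes column \<open>j\<close> only in row \<open>r\<close> and nothing to the left of it.\<close>

definition first_violation :: "(nat \<times> nat) set \<Rightarrow> (nat \<times> nat \<Rightarrow> letter) \<Rightarrow> nat \<Rightarrow> nat \<Rightarrow> bool" where
  "first_violation D T r j \<longleftrightarrow>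
     violation D T r j \<and> (\<forall>i j'. j' < j \<longrightarrow> \<not> violation D T i j') \<and>
     (\<forall>i > r. \<not> violation D T i j)"

lemma first_violation_unique:
  assumes "first_violation D T r j" "first_violation D T r' j'"
  shows "r = r' \<and> j = j'"
  using assms unfolding first_violation_def by (metis linorder_neqE_nat)

lemma ex_first_violation:
  assumes "finite D" "violation D T i j"
  shows "\<exists>r j. first_violation D T r j"
proof -
  define j0 where "j0 = (LEAST j. \<exists>i. violation D T i j)"
  have ex: "\<exists>i. violation D T i j0"
    unfolding j0_def by (rule LeastI[of _ j]) (use assms(2) in blast)
  \<comment> \<open>A violation in row \<open>i\<close> needs a cell of \<open>D\<close> in row
    \<open>Suc i\<close>, so only finitely many rows qualify and a topmost one exists.\<close>
  have "Suc ` {i. violation D T i j0} \<subseteq> fst ` D"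
    by (force simp: violation_def)
  then have fin: "finite {i. violation D T i j0}"
    using assms(1) by (metis finite_imageD finite_imageI finite_subset inj_Suc inj_on_subset subset_UNIV)
  define r0 where "r0 = Max {i. violation D T i j0}"
  have "violation D T r0 j0"
    using Max_in[OF fin] ex unfolding r0_def by auto
  moreover have "\<not> violation D T i j0" if "i > r0" for i
    using Max_ge[OF fin, of i] that unfolding r0_def by auto
  moreover have "\<not> violation D T i j'" if "j' < j0" for i j'
    using not_less_Least[of j' "\<lambda>j. \<exists>i. violation D T i j"] that unfolding j0_def by auto
  ultimately show ?thesis unfolding first_violation_def by blast
qed

text \<open>This acts on positions; the new filling is \<open>T \<circ> exchange_tails r j\<close>.
  Row \<open>r\<close> from column \<open>j\<close> on is paired with row \<open>Suc r\<close> from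
  column \<open>Suc j\<close> on, while cell \<open>(Suc r, j)\<close> stays put. The diagonal shift
  matches the terms \<open>i - \<tau> i\<close> in the row lengths.\<close>

definition exchange_tails :: "nat \<Rightarrow> nat \<Rightarrow> nat \<times> nat \<Rightarrow> nat \<times> nat" where
  "exchange_tails r j = (\<lambda>(i, c).
     if i = r \<and> j \<le> c then (Suc r, Suc c)
     else if i = Suc r \<and> j < c then (r, c - 1)
     else (i, c))"

lemma exchange_tails_involution [simp]: "exchange_tails r j (exchange_tails r j c) = c"
  by (cases c) (auto simp: exchange_tails_def)

lemma exchange_tails_comp: "exchange_tails r j \<circ> exchange_tails r j = id"
  by (simp add: fun_eq_iff)

text \<open>Row \<open>r\<close> keeps \<open>j\<close> cells and receives
  \<open>s (Suc r) - j - 1\<close>; row \<open>Suc r\<close> keeps \<open>j + 1\<close> and receives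
  \<open>s r - j\<close>. The column \<open>j\<close> cancels in both lengths.\<close>

definition exchange_lengths :: "nat \<Rightarrow> (nat \<Rightarrow> nat) \<Rightarrow> nat \<Rightarrow> nat" where
  "exchange_lengths r s = s(r := s (Suc r) - 1, Suc r := Suc (s r))"

lemma exchange_tails_mem_rows:
  assumes "Suc r < m" "j < s (Suc r)" "j \<le> s r"
  shows "exchange_tails r j c \<in> rows m s \<longleftrightarrow> c \<in> rows m (exchange_lengths r s)"
  using assms by (cases c) (auto simp: exchange_tails_def exchange_lengths_def mem_rows)

lemma bij_betw_exchange_tails:
  assumes "Suc r < m" "j < s (Suc r)" "j \<le> s r"
  shows "bij_betw (exchange_tails r j) (rows m (exchange_lengths r s)) (rows m s)"
  by (rule bij_betw_byWitness[where f' = "exchange_tails r j"])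
    (use exchange_tails_mem_rows[OF assms] in \<open>auto, metis exchange_tails_involution\<close>)

text \<open>In column 0 no cell is missing and the entries increase, so the violation lies further
  right. Column \<open>j - 1\<close> then has no violation, so \<open>(r, j - 1)\<close> is a cell,
  which gives \<open>j \<le> s r\<close>.\<close>

lemma first_violation_bounds:
  assumes T: "T \<in> imm_fillings A (rows m s)" and pos: "\<And>i. i < m \<Longrightarrow> 0 < s i"
    and fv: "first_violation (rows m s) T r j"
  shows "Suc r < m" "j < s (Suc r)" "j \<le> s r" "0 < j"
proof -
  have v: "violation (rows m s) T r j" using fv by (simp add: first_violation_def)
  show b: "Suc r < m" "j < s (Suc r)" using v by (auto simp: violation_def mem_rows)
  show "0 < j"
  proof (rule ccontr)
    assume "\<not> 0 < j"
    then have "\<not> col_incr (T (r, 0)) (T (Suc r, 0))"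
      using v pos b by (simp add: violation_def mem_rows)
    moreover have "col_incr (T (r, 0)) (T (Suc r, 0))"
      using T b pos by (auto simp: imm_fillings_def mem_rows)
    ultimately show False by simp
  qed
  then have "\<not> violation (rows m s) T r (j - 1)"
    using fv by (auto simp: first_violation_def)
  then show "j \<le> s r" using b by (auto simp: violation_def mem_rows)
qed

text \<open>Away from the two cuts, rows inherit their order. The cut in row \<open>r\<close> is
  handled by the absence of violations left of column \<open>j\<close>, the cut in row
  \<open>Suc r\<close> by the violation itself.\<close>

lemma exchange_tails_imm_fillings:
  assumes T: "T \<in> imm_fillings A (rows m s)" and pos: "\<And>i. i < m \<Longrightarrow> 0 < s i"
    and fv: "first_violation (rows m s) T r j"
  shows "T \<circ> exchange_tails r j \<in> imm_fillings A (rows m (exchange_lengths r s))"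
proof -
  note b = first_violation_bounds[OF T pos fv]
  have row: "row_incr (T (i, c)) (T (i, c'))" if "i < m" "c < c'" "c' < s i" for i c c'
    using T that by (auto simp: imm_fillings_def mem_rows)
  have left: "c < s r \<and> col_incr (T (r, c)) (T (Suc r, c))" if "c < j" for c
  proof -
    have "\<not> violation (rows m s) T r c" using fv that by (auto simp: first_violation_def)
    then show ?thesis using b that by (auto simp: violation_def mem_rows)
  qed
  have at: "row_incr (T (Suc r, j)) (T (r, j))" if "j < s r"
  proof -
    have "violation (rows m s) T r j" using fv by (simp add: first_violation_def)
    then show ?thesis using that b by (simp add: violation_def mem_rows not_col_incr_iff)
  qed
  \<comment> \<open>Across the cut of the new row \<open>r\<close>: up in column \<open>c\<close>,
    where nothing is violated, then right in row \<open>Suc r\<close>.\<close>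
  have lower: "row_incr (T (r, c)) (T (Suc r, c'))" if "c < j" "j < c'" "c' < s (Suc r)" for c c'
  proof (rule col_row_incr_trans)
    show "col_incr (T (r, c)) (T (Suc r, c))" using left[OF that(1)] by simp
    show "row_incr (T (Suc r, c)) (T (Suc r, c'))" by (rule row) (use that b in auto)
  qed
  \<comment> \<open>Across the cut of the new row \<open>Suc r\<close>: right to column
    \<open>j\<close>, down through the violation, then right in row \<open>r\<close>.\<close>
  have upper: "row_incr (T (Suc r, c)) (T (r, c'))" if "c \<le> j" "j \<le> c'" "c' < s r" for c c'
  proof -
    have at: "row_incr (T (Suc r, j)) (T (r, j))" by (rule at) (use that in simp)
    have *: "row_incr (T (Suc r, c)) (T (r, j))"
    proof (cases "c = j")
      case False
      then have "row_incr (T (Suc r, c)) (T (Suc r, j))" by (intro row) (use that b in auto)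
      then show ?thesis using at by (rule row_incr_trans)
    qed (use at in simp)
    show ?thesis
    proof (cases "c' = j")
      case False
      then have "row_incr (T (r, j)) (T (r, c'))" by (intro row) (use that b in auto)
      with * show ?thesis by (rule row_incr_trans)
    qed (use * in simp)
  qed
  have "T \<circ> exchange_tails r j \<in> rows m (exchange_lengths r s) \<rightarrow>\<^sub>E A"
    using T exchange_tails_mem_rows[OF b(1-3)]
    by (simp add: imm_fillings_def PiE_iff extensional_def del: split_paired_All)
  \<comment> \<open>Since \<open>0 < j\<close>, the exchange fixes every cell of column 0.\<close>
  moreover have "col_incr (T (exchange_tails r j (i, 0))) (T (exchange_tails r j (i', 0)))"
    if "i < i'" "i' < m" for i i'
    using T that b(4) pos[of i] pos[of i'] by (auto simp: exchange_tails_def imm_fillings_def mem_rows)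
  moreover have "row_incr (T (exchange_tails r j (i, c))) (T (exchange_tails r j (i, c')))"
    if "i < m" "c < c'" "c' < exchange_lengths r s i" for i c c'
  proof -
    consider "i = r" | "i = Suc r" | "i \<noteq> r" "i \<noteq> Suc r" by blast
    then show ?thesis
    proof cases
      case 1
      then show ?thesis using that b row[of r c c'] row[of "Suc r" "Suc c" "Suc c'"]
          left[of c'] lower[of c "Suc c'"]
        by (auto simp: exchange_tails_def exchange_lengths_def)
    next
      case 2
      then show ?thesis using that b row[of "Suc r" c c'] row[of r "c - 1" "c' - 1"]
          upper[of c "c' - 1"]
        by (auto simp: exchange_tails_def exchange_lengths_def)
    next
      case 3
      then show ?thesis using that row[of i c c']
        by (auto simp: exchange_tails_def exchange_lengths_def)
    qed
  qed
  ultimately show ?thesis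
    by (auto simp: imm_fillings_def mem_rows)
qed

text \<open>Below the unchanged entry at \<open>(Suc r, j)\<close> now stands the old entry at
  \<open>(Suc r, Suc j)\<close>, or nothing; either way this is a violation. Cells left of column
  \<open>j\<close>, and those of column \<open>j\<close> outside row \<open>r\<close>, are
  untouched, so no violation with higher priority arises.\<close>

lemma exchange_tails_first_violation:
  assumes T: "T \<in> imm_fillings A (rows m s)" and pos: "\<And>i. i < m \<Longrightarrow> 0 < s i"
    and fv: "first_violation (rows m s) T r j"
  shows "first_violation (rows m (exchange_lengths r s)) (T \<circ> exchange_tails r j) r j"
proof -
  note b = first_violation_bounds[OF T pos fv]
  let ?D = "rows m s" and ?E = "rows m (exchange_lengths r s)" and ?U = "T \<circ> exchange_tails r j"
  have "row_incr (T (Suc r, j)) (T (Suc r, Suc j))" if "Suc j < s (Suc r)"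
    using T b that by (auto simp: imm_fillings_def mem_rows)
  then have "violation ?E ?U r j"
    using b by (auto simp: violation_def mem_rows exchange_tails_def exchange_lengths_def
        not_col_incr_iff)
  moreover have same: "(i, c) \<in> ?E \<longleftrightarrow> (i, c) \<in> ?D" "?U (i, c) = T (i, c)"
    if "c < j \<or> (c = j \<and> i \<noteq> r)" for i c
    using b that by (auto simp: mem_rows exchange_tails_def exchange_lengths_def)
  have "violation ?E ?U i c \<longleftrightarrow> violation ?D T i c" if "c < j \<or> (c = j \<and> i > r)" for i c
    using same[of c i] same[of c "Suc i"] that by (auto simp: violation_def)
  then have "\<not> violation ?E ?U i c" if "c < j \<or> (c = j \<and> i > r)" for i c
    using fv that by (auto simp: first_violation_def)
  ultimately show ?thesis by (simp add: first_violation_def)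
qed

section \<open>Signed sum over permutations and their fillings\<close>

definition perm_length :: "nat list \<Rightarrow> (nat \<Rightarrow> nat) \<Rightarrow> nat \<Rightarrow> nat" where
  "perm_length p \<tau> i = nat (int (p ! \<tau> i) + int i - int (\<tau> i))"

text \<open>As \<open>perm_length\<close> truncates at 0, its positivity in all rows says exactly
  that \<open>perm_shape \<tau> p\<close> is defined.\<close>

definition perm_fillings ::
    "letter set \<Rightarrow> nat list \<Rightarrow> ((nat \<Rightarrow> nat) \<times> (nat \<times> nat \<Rightarrow> letter)) set" where
  "perm_fillings A p =
     Sigma {\<tau>. \<tau> permutes {..<length p} \<and> (\<forall>i<length p. 0 < perm_length p \<tau> i)}
       (\<lambda>\<tau>. imm_fillings A (rows (length p) (perm_length p \<tau>)))"

lemma finite_imm_fillings: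
  assumes "finite A" "finite D"
  shows "finite (imm_fillings A D)"
proof (rule finite_subset)
  show "imm_fillings A D \<subseteq> D \<rightarrow>\<^sub>E A" by (auto simp: imm_fillings_def)
qed (use assms in \<open>simp add: finite_PiE\<close>)

lemma finite_letters: "finite (letters l k)"
  by (simp add: letters_def)

text \<open>The value \<open>\<tau> (Suc r)\<close> now sits one row lower and
  \<open>\<tau> r\<close> one row higher, so the term \<open>i\<close> changes by 1 in each: the
  same effect as exchanging tails. Positivity keeps the truncation by \<open>nat\<close> from
  interfering.\<close>

lemma perm_length_transpose:
  assumes "0 < perm_length p \<tau> r" "0 < perm_length p \<tau> (Suc r)"
  shows "perm_length p (\<tau> \<circ> transpose r (Suc r)) = exchange_lengths r (perm_length p \<tau>)"
  using assms
  by (auto simp: fun_eq_iff perm_length_def exchange_lengths_def transpose_def)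

lemma hook_dual_immaculate_eq:
  "hook_dual_immaculate l k \<alpha> =
     (\<Sum>T \<in> imm_fillings (letters l k) (diagram \<alpha>). \<Prod>c \<in> diagram \<alpha>. z_var (T c))"
  unfolding hook_dual_immaculate_def
proof (rule sum.cong)
  fix T assume "T \<in> imm_fillings (letters l k) (diagram \<alpha>)"
  then have "T ` diagram \<alpha> \<subseteq> letters l k" by (auto simp: imm_fillings_def)
  then show "(\<Prod>a \<in> letters l k. z_var a ^ card {c \<in> diagram \<alpha>. T c = a}) =
      (\<Prod>c \<in> diagram \<alpha>. z_var (T c))"
    by (rule prod_power_card_fibre[OF finite_letters finite_diagram])
qed (simp add: hook_immaculate_tableaux_def imm_fillings_def)

lemma hook_dual_immaculate_opt_perm_shape:
  "hook_dual_immaculate_opt l k (perm_shape \<tau> p) =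
     (if \<forall>i<length p. 0 < perm_length p \<tau> i
      then \<Sum>T \<in> imm_fillings (letters l k) (rows (length p) (perm_length p \<tau>)).
             \<Prod>c \<in> rows (length p) (perm_length p \<tau>). z_var (T c)
      else 0)"
proof -
  have *: "diagram (map nat (perm_entries \<tau> p)) = rows (length p) (perm_length p \<tau>)"
    by (auto simp: diagram_def rows_def perm_entries_def perm_length_def)
  have "(\<forall>e \<in> set (perm_entries \<tau> p). 0 < e) \<longleftrightarrow> (\<forall>i<length p. 0 < perm_length p \<tau> i)"
    by (auto simp: perm_entries_def perm_length_def)
  note eqs = this hook_dual_immaculate_opt_def perm_shape_def hook_dual_immaculate_eq * option.case
  show ?thesis
  proof (cases "\<forall>i<length p. 0 < perm_length p \<tau> i")
    case True
    show ?thesis by (simp only: eqs if_P[OF True])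
  next
    case False
    show ?thesis by (simp only: eqs if_not_P[OF False])
  qed
qed

lemma sum_perm_fillings:
  "(\<Sum>\<tau> | \<tau> permutes {..<length p}.
       of_int (sign \<tau>) * hook_dual_immaculate_opt l k (perm_shape \<tau> p)) =
   (\<Sum>(\<tau>, T) \<in> perm_fillings (letters l k) p.
       of_int (sign \<tau>) * (\<Prod>c \<in> rows (length p) (perm_length p \<tau>). z_var (T c)))"
proof -
  let ?P = "{\<tau>. \<tau> permutes {..<length p}}"
  let ?Q = "{\<tau>. \<tau> permutes {..<length p} \<and> (\<forall>i<length p. 0 < perm_length p \<tau> i)}"
  have fin: "finite ?P" "finite ?Q"
    using finite_permutations[of "{..<length p}"] by auto
  \<comment> \<open>Permutations with undefined shape contribute 0.\<close>
  have "(\<Sum>\<tau>\<in>?P. of_int (sign \<tau>) * hook_dual_immaculate_opt l k (perm_shape \<tau> p)) =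
      (\<Sum>\<tau>\<in>?Q. of_int (sign \<tau>) * hook_dual_immaculate_opt l k (perm_shape \<tau> p))"
    by (rule sum.mono_neutral_right[OF fin(1)])
      (auto simp: hook_dual_immaculate_opt_perm_shape)
  also have "\<dots> = (\<Sum>\<tau>\<in>?Q. \<Sum>T \<in> imm_fillings (letters l k) (rows (length p) (perm_length p \<tau>)).
       of_int (sign \<tau>) * (\<Prod>c \<in> rows (length p) (perm_length p \<tau>). z_var (T c)))"
    by (rule sum.cong) (auto simp: hook_dual_immaculate_opt_perm_shape sum_distrib_left)
  also have "\<dots> = (\<Sum>(\<tau>, T) \<in> perm_fillings (letters l k) p.
       of_int (sign \<tau>) * (\<Prod>c \<in> rows (length p) (perm_length p \<tau>). z_var (T c)))"
    unfolding perm_fillings_def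
    by (rule sum.Sigma) (auto simp: fin finite_imm_fillings finite_letters finite_rows)
  finally show ?thesis .
qed

text \<open>Reindexing by \<open>g\<close> shows that the sum is its own negative; so is each
  coefficient, and an integer equal to its negative is 0.\<close>

lemma sum_sign_reversing:
  fixes f :: "'a \<Rightarrow> 'b \<Rightarrow>\<^sub>0 int"
  assumes "\<And>x. x \<in> S \<Longrightarrow> g x \<in> S" "\<And>x. x \<in> S \<Longrightarrow> g (g x) = x" "\<And>x. x \<in> S \<Longrightarrow> f (g x) = - f x"
  shows "sum f S = 0"
proof -
  have "sum f S = (\<Sum>x\<in>S. - f x)"
    by (rule sum.reindex_bij_witness[where i = g and j = g]) (use assms in auto)
  then have eq: "sum f S = - sum f S" by (simp add: sum_negf)
  have "Poly_Mapping.lookup (sum f S) a = 0" for a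
    using arg_cong[OF eq, of "\<lambda>g. Poly_Mapping.lookup g a"] by (simp only: lookup_uminus equal_neg_zero)
  then show ?thesis by (simp add: poly_mapping_eq_iff fun_eq_iff)
qed

text \<open>Composing \<open>\<tau>\<close> with an adjacent transposition and \<open>T\<close> with
  the exchange at the first violation flips the sign and keeps the monomial.\<close>

lemma sum_violating_fillings:
  "(\<Sum>(\<tau>, T) \<in> {(\<tau>, T) \<in> perm_fillings A p.
         \<exists>i j. violation (rows (length p) (perm_length p \<tau>)) T i j}.
       of_int (sign \<tau>) * (\<Prod>c \<in> rows (length p) (perm_length p \<tau>). z_var (T c))) = 0"
proof -
  let ?m = "length p"
  let ?D = "\<lambda>\<tau>. rows ?m (perm_length p \<tau>)"
  let ?S = "{(\<tau>, T) \<in> perm_fillings A p. \<exists>i j. violation (?D \<tau>) T i j}"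
  \<comment> \<open>\<open>THE\<close> is meaningful only where a violation exists; there the first
    violation is unique.\<close>
  define g where "g = (\<lambda>(\<tau>, T). case THE (r, j). first_violation (?D \<tau>) T r j of
    (r, j) \<Rightarrow> (\<tau> \<circ> transpose r (Suc r), T \<circ> exchange_tails r j))"
  have g_eq: "g (\<tau>, T) = (\<tau> \<circ> transpose r (Suc r), T \<circ> exchange_tails r j)"
    if "first_violation (?D \<tau>) T r j" for \<tau> T r j
  proof -
    have "(THE (r, j). first_violation (?D \<tau>) T r j) = (r, j)"
      by (rule the_equality) (use that first_violation_unique in \<open>auto\<close>)
    then show ?thesis by (simp add: g_def)
  qed
  have *: "g x \<in> ?S \<and> g (g x) = x \<and>
      (case g x of (\<tau>, T) \<Rightarrow> of_int (sign \<tau>) * (\<Prod>c \<in> ?D \<tau>. z_var (T c))) =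
      - (case x of (\<tau>, T) \<Rightarrow> of_int (sign \<tau>) * (\<Prod>c \<in> ?D \<tau>. z_var (T c)))"
    if "x \<in> ?S" for x
  proof -
    obtain \<tau> T where x: "x = (\<tau>, T)" by (cases x)
    note xS = that[unfolded x]
    let ?s = "perm_length p \<tau>"
    have perm: "\<tau> permutes {..<?m}" and pos: "\<And>i. i < ?m \<Longrightarrow> 0 < ?s i"
      and T: "T \<in> imm_fillings A (?D \<tau>)"
      using xS by (auto simp: perm_fillings_def)
    obtain i0 j0 where "violation (?D \<tau>) T i0 j0" using xS by auto
    then obtain r j where fv: "first_violation (?D \<tau>) T r j"
      using ex_first_violation[OF finite_rows] by metis
    note b = first_violation_bounds[OF T pos fv]
    let ?\<tau>' = "\<tau> \<circ> transpose r (Suc r)" and ?T' = "T \<circ> exchange_tails r j"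
    have s': "perm_length p ?\<tau>' = exchange_lengths r ?s"
      using perm_length_transpose b pos by simp
    have gx: "g x = (?\<tau>', ?T')" using g_eq[OF fv] x by simp
    have fv': "first_violation (?D ?\<tau>') ?T' r j"
      using exchange_tails_first_violation[OF T pos fv] by (simp add: s')
    have tr: "transpose r (Suc r) permutes {..<?m}"
      using b by (intro permutes_swap_id) auto
    then have perm': "?\<tau>' permutes {..<?m}"
      using perm by (rule permutes_compose)
    have pos': "0 < perm_length p ?\<tau>' i" if "i < ?m" for i
      using pos[OF that] b by (auto simp: s' exchange_lengths_def)
    have "?T' \<in> imm_fillings A (?D ?\<tau>')"
      using exchange_tails_imm_fillings[OF T pos fv] by (simp add: s')
    then have "g x \<in> ?S"
      using perm' pos' fv' by (auto simp: gx perm_fillings_def first_violation_def)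
    \<comment> \<open>As \<open>(r, j)\<close> is again the first violation, the second application
      repeats the same exchange and undoes it.\<close>
    moreover have "g (g x) = x"
      unfolding gx g_eq[OF fv'] by (simp add: x comp_assoc exchange_tails_comp transpose_comp_involutory)
    moreover have "sign ?\<tau>' = - sign \<tau>"
      using perm tr by (subst sign_compose) (auto simp: sign_swap_id permutation_permutes)
    \<comment> \<open>The exchange is a bijection between the two shapes, so both fillings have the
      same entries with multiplicity.\<close>
    moreover have "(\<Prod>c \<in> ?D ?\<tau>'. z_var (?T' c)) = (\<Prod>c \<in> ?D \<tau>. z_var (T c))"
      using prod.reindex_bij_betw[OF bij_betw_exchange_tails[OF b(1-3)], of "\<lambda>c. z_var (T c)"]
      by (simp add: s')
    ultimately show ?thesis unfolding gx by (simp add: x)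
  qed
  show ?thesis
    by (rule sum_sign_reversing[where g = g]; drule *) simp_all
qed


section \<open>The fixed points\<close>

text \<open>For the diagram of a partition and \<open>A = letters l k\<close> these are the
  \<open>(l, k)\<close>-semistandard tableaux: every column is constrained, not only the
  first.\<close>

definition hook_fillings :: "letter set \<Rightarrow> (nat \<times> nat) set \<Rightarrow> (nat \<times> nat \<Rightarrow> letter) set" where
  "hook_fillings A D =
     {T \<in> D \<rightarrow>\<^sub>E A.
        (\<forall>i i' j. (i, j) \<in> D \<and> (i', j) \<in> D \<and> i < i' \<longrightarrow> col_incr (T (i, j)) (T (i', j))) \<and>
        (\<forall>i j j'. (i, j) \<in> D \<and> (i, j') \<in> D \<and> j < j' \<longrightarrow> row_incr (T (i, j)) (T (i, j')))}"

lemma partition_nth_antimono: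
  assumes "is_partition p" "i \<le> i'" "i' < length p"
  shows "p ! i' \<le> p ! i"
  using assms sorted_wrt_nth_less[of "(\<ge>)" p i i'] by (cases "i = i'") (auto simp: is_partition_def)

lemma diagram_down_closed:
  assumes "is_partition p" "(i', j') \<in> diagram p" "i \<le> i'" "j \<le> j'"
  shows "(i, j) \<in> diagram p"
  using assms partition_nth_antimono[OF assms(1), of i i'] by (auto simp: diagram_def)

lemma perm_length_id: "perm_length p id = nth p"
  by (simp add: perm_length_def fun_eq_iff)

text \<open>Row lengths must weakly decrease. But if \<open>\<tau> i \<ge> \<tau> (Suc i)\<close>,
  then \<open>p ! \<tau> i \<le> p ! \<tau> (Suc i)\<close>, and the term \<open>i\<close> makes row
  \<open>Suc i\<close> strictly longer than row \<open>i\<close>. So \<open>\<tau>\<close> is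
  strictly increasing on the indices, which leaves only the identity.\<close>

lemma no_violation_imp_id:
  assumes p: "is_partition p" and perm: "\<tau> permutes {..<length p}"
    and pos: "\<And>i. i < length p \<Longrightarrow> 0 < perm_length p \<tau> i"
    and no: "\<And>i j. \<not> violation (rows (length p) (perm_length p \<tau>)) T i j"
  shows "\<tau> = id"
proof (rule permutes_natset_ge[OF perm])
  have step: "\<tau> i < \<tau> (Suc i)" if "Suc i < length p" for i
  proof (rule ccontr)
    assume c: "\<not> \<tau> i < \<tau> (Suc i)"
    \<comment> \<open>The column chosen is the one just past the end of row \<open>i\<close>: a cell
      of row \<open>Suc i\<close> there would have nothing below it.\<close>
    have "\<not> perm_length p \<tau> i < perm_length p \<tau> (Suc i)"
      using no[of i "perm_length p \<tau> i"] that by (auto simp: violation_def mem_rows)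
    moreover have "p ! \<tau> i \<le> p ! \<tau> (Suc i)"
      using c that permutes_in_image[OF perm] by (intro partition_nth_antimono[OF p]) auto
    ultimately show False
      using c pos[OF that] pos[of i] that by (auto simp: perm_length_def)
  qed
  have "i < length p \<longrightarrow> i \<le> \<tau> i" for i
    by (induction i) (use step in fastforce)+
  then show "\<forall>i \<in> {..<length p}. i \<le> \<tau> i" by simp
qed

text \<open>Once the permutation is the identity, the shape is down-closed and no cell below is ever
  missing. Having no violation then means that vertically adjacent entries increase, and
  transitivity extends this to whole columns.\<close>

lemma nonviolating_fillings:
  assumes p: "is_partition p"
  shows "{(\<tau>, T) \<in> perm_fillings A p.
           \<not> (\<exists>i j. violation (rows (length p) (perm_length p \<tau>)) T i j)} =
         {id} \<times> hook_fillings A (diagram p)" (is "?L = ?R")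
proof (intro equalityI subsetI)
  fix x assume "x \<in> ?L"
  then obtain \<tau> T where x: "x = (\<tau>, T)" and perm: "\<tau> permutes {..<length p}"
    and pos: "\<And>i. i < length p \<Longrightarrow> 0 < perm_length p \<tau> i"
    and T: "T \<in> imm_fillings A (rows (length p) (perm_length p \<tau>))"
    and no: "\<And>i j. \<not> violation (rows (length p) (perm_length p \<tau>)) T i j"
    by (auto simp: perm_fillings_def)
  have \<tau>: "\<tau> = id" by (rule no_violation_imp_id[OF p perm pos no])
  have T: "T \<in> imm_fillings A (diagram p)" and no: "\<And>i j. \<not> violation (diagram p) T i j"
    using T no by (simp_all add: \<tau> perm_length_id diagram_eq_rows)
  have "col_incr (T (i, j)) (T (i', j))" if "i < i'" "(i', j) \<in> diagram p" for i i' j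
    using that
  proof (induction i' rule: less_induct)
    case (less i')
    then obtain i0 where i0: "i' = Suc i0" by (cases i') auto
    have in0: "(i0, j) \<in> diagram p"
      by (rule diagram_down_closed[OF p less.prems(2)]) (simp_all add: i0)
    then have "col_incr (T (i0, j)) (T (i', j))"
      using no[of i0 j] less.prems by (simp add: violation_def i0)
    moreover have "col_incr (T (i, j)) (T (i0, j))" if "i \<noteq> i0"
      by (rule less.IH) (use that in0 less.prems i0 in auto)
    ultimately show ?case using col_incr_trans by blast
  qed
  then show "x \<in> ?R" using T by (auto simp: x \<tau> hook_fillings_def imm_fillings_def)
next
  fix x assume "x \<in> ?R"
  then obtain T where x: "x = (id, T)" and T: "T \<in> hook_fillings A (diagram p)" by auto
  have "\<not> violation (diagram p) T i j" for i j
    using T diagram_down_closed[OF p, of "Suc i" j i j]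
    by (auto simp: violation_def hook_fillings_def)
  moreover have "T \<in> imm_fillings A (diagram p)"
    using T by (auto simp: imm_fillings_def hook_fillings_def)
  ultimately show "x \<in> ?L"
    using p by (auto simp: x perm_fillings_def perm_length_id diagram_eq_rows permutes_id
        is_partition_def)
qed

lemma sum_perm_fillings_eq_hook_fillings:
  assumes p: "is_partition p"
  shows "(\<Sum>\<tau> | \<tau> permutes {..<length p}.
       of_int (sign \<tau>) * hook_dual_immaculate_opt l k (perm_shape \<tau> p)) =
     (\<Sum>T \<in> hook_fillings (letters l k) (diagram p). \<Prod>c \<in> diagram p. z_var (T c))"
proof -
  let ?P = "perm_fillings (letters l k) p"
  let ?V = "\<lambda>(\<tau>, T). \<exists>i j. violation (rows (length p) (perm_length p \<tau>)) T i j"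
  let ?f = "\<lambda>(\<tau>, T). of_int (sign \<tau>) * (\<Prod>c \<in> rows (length p) (perm_length p \<tau>). z_var (T c))"
  have "finite ?P"
    unfolding perm_fillings_def
    by (rule finite_SigmaI)
      (auto simp: finite_imm_fillings finite_letters finite_rows finite_permutations)
  \<comment> \<open>The violating part cancels; in the other part only the identity occurs, with
    sign 1.\<close>
  then have "sum ?f ?P = sum ?f {x \<in> ?P. ?V x} + sum ?f {x \<in> ?P. \<not> ?V x}"
    by (subst sum.union_disjoint[symmetric]) (auto intro: sum.cong)
  also have "{x \<in> ?P. ?V x} =
      {(\<tau>, T) \<in> ?P. \<exists>i j. violation (rows (length p) (perm_length p \<tau>)) T i j}" by auto
  also have "{x \<in> ?P. \<not> ?V x} =
      {(\<tau>, T) \<in> ?P. \<not> (\<exists>i j. violation (rows (length p) (perm_length p \<tau>)) T i j)}" by auto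
  finally show ?thesis
    by (simp add: sum_perm_fillings sum_violating_fillings nonviolating_fillings[OF p]
        sum.cartesian_product[symmetric] perm_length_id diagram_eq_rows del: not_ex)
qed


section \<open>Splitting a filling into its unprimed and primed parts\<close>

lemma down_closed_eq_lessThan:
  fixes S :: "nat set"
  assumes "finite S" "\<And>i i'. i' \<in> S \<Longrightarrow> i \<le> i' \<Longrightarrow> i \<in> S"
  shows "S = {..<card S}"
proof -
  \<comment> \<open>The least number missing from \<open>S\<close>; down-closedness then excludes
    everything above it.\<close>
  define n where "n = (LEAST n. n \<notin> S)"
  have "\<exists>n. n \<notin> S" using ex_new_if_finite[OF infinite_UNIV_nat assms(1)] .
  then have "n \<notin> S" unfolding n_def by (rule LeastI_ex)
  moreover have "i \<in> S" if "i < n" for i using that not_less_Least unfolding n_def by blast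
  ultimately have "S = {..<n}" using assms(2) by (auto simp: not_le[symmetric])
  then show ?thesis by simp
qed

text \<open>The rows meeting column \<open>j\<close> form an initial segment, so comparing
  \<open>i\<close> with their number decides membership.\<close>

lemma mem_diagram_conjugate:
  assumes p: "is_partition p"
  shows "(j, i) \<in> diagram (conjugate p) \<longleftrightarrow> (i, j) \<in> diagram p"
proof -
  let ?S = "{i. i < length p \<and> j < p ! i}"
  have "?S = {..<card ?S}"
  proof (rule down_closed_eq_lessThan)
    show "i \<in> ?S" if "i' \<in> ?S" "i \<le> i'" for i i'
      using diagram_down_closed[OF p, of i' j i j] that by (auto simp: diagram_def)
  qed simp
  then have *: "i < card ?S \<longleftrightarrow> i < length p \<and> j < p ! i" by blast
  have le: "a \<le> foldr max xs 0" if "a \<in> set xs" for a :: nat and xs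
    using that by (induction xs) auto
  \<comment> \<open>An occupied column lies within the length of \<open>conjugate p\<close>, which
    is the largest part.\<close>
  have "j < foldr max p 0" if "i < length p" "j < p ! i"
    using le[of "p ! i" p] that by simp
  then show ?thesis using * by (auto simp: diagram_def conjugate_def)
qed

lemma ex_partition_diagram:
  assumes fin: "finite E"
    and down: "\<And>i j i' j'. (i', j') \<in> E \<Longrightarrow> i \<le> i' \<Longrightarrow> j \<le> j' \<Longrightarrow> (i, j) \<in> E"
  shows "\<exists>q. is_partition q \<and> diagram q = E"
proof -
  define s where "s i = card {j. (i, j) \<in> E}" for i
  \<comment> \<open>By down-closedness every nonempty row meets column 0, so \<open>n\<close> counts
    the nonempty rows and all parts of \<open>?q\<close> are positive.\<close>
  define n where "n = card {i. (i, 0::nat) \<in> E}"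
  have "{j. (i, j) \<in> E} \<subseteq> snd ` E" for i by force
  then have fin_row: "finite {j. (i, j) \<in> E}" for i
    using fin by (meson finite_imageI finite_subset)
  have row: "(i, j) \<in> E \<longleftrightarrow> j < s i" for i j
    using down_closed_eq_lessThan[OF fin_row[of i]] down unfolding s_def by blast
  have "{i. (i, 0) \<in> E} \<subseteq> fst ` E" by force
  then have "finite {i. (i, 0) \<in> E}"
    using fin by (meson finite_imageI finite_subset)
  then have col: "(i, 0) \<in> E \<longleftrightarrow> i < n" for i
    using down_closed_eq_lessThan[of "{i. (i, 0) \<in> E}"] down unfolding n_def by blast
  let ?q = "map s [0..<n]"
  have "s i' \<le> s i" if "i \<le> i'" for i i'
    unfolding s_def by (rule card_mono[OF fin_row]) (use down that in blast)
  then have "is_partition ?q"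
    using row col by (auto simp: is_partition_def sorted_wrt_iff_nth_less)
  moreover have "(i, j) \<in> diagram ?q \<longleftrightarrow> (i, j) \<in> E" for i j
    using row col down[of i j i 0] by (auto simp: diagram_def)
  ultimately show ?thesis by auto
qed

lemma diagram_inj:
  assumes p: "is_partition p" and q: "is_partition q" and eq: "diagram p = diagram q"
  shows "p = q"
proof -
  \<comment> \<open>Parts are positive, so column 0 meets every row and reveals the length.\<close>
  have len: "{i. (i, 0) \<in> diagram p} = {..<length p}" if "is_partition p" for p
    using that by (auto simp: diagram_def is_partition_def)
  have "length p = length q"
    using len[OF p] len[OF q] eq by simp
  moreover have "p ! i = q ! i" if "i < length p" for i
  proof -
    have "{j. (i, j) \<in> diagram p} = {..<p ! i}" "{j. (i, j) \<in> diagram q} = {..<q ! i}"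
      using that \<open>length p = length q\<close> by (auto simp: diagram_def)
    then show ?thesis using eq by simp
  qed
  ultimately show ?thesis by (simp add: list_eq_iff_nth_eq)
qed

text \<open>Arbitrary cell sets are allowed, so that the transposed skew part can be given directly
  as a set of swapped cells.\<close>

definition ssyt_on :: "nat \<Rightarrow> (nat \<times> nat) set \<Rightarrow> (nat \<times> nat \<Rightarrow> nat) set" where
  "ssyt_on n D =
     {T \<in> D \<rightarrow>\<^sub>E {1..n}.
        (\<forall>i j j'. (i, j) \<in> D \<and> (i, j') \<in> D \<and> j < j' \<longrightarrow> T (i, j) \<le> T (i, j')) \<and>
        (\<forall>i i' j. (i, j) \<in> D \<and> (i', j) \<in> D \<and> i < i' \<longrightarrow> T (i, j) < T (i', j))}"

lemma skew_schur_eq: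
  "skew_schur n v p q =
     (\<Sum>T \<in> ssyt_on n (diagram p - diagram q). \<Prod>c \<in> diagram p - diagram q. v (T c))"
  unfolding skew_schur_def
proof (rule sum.cong)
  fix T assume "T \<in> ssyt_on n (diagram p - diagram q)"
  then have "T ` (diagram p - diagram q) \<subseteq> {1..n}" by (auto simp: ssyt_on_def)
  then show "(\<Prod>a \<in> {1..n}. v a ^ card {c \<in> diagram p - diagram q. T c = a}) =
      (\<Prod>c \<in> diagram p - diagram q. v (T c))"
    by (intro prod_power_card_fibre) (simp_all add: finite_diagram)
qed (simp add: skew_ssyt_def ssyt_on_def)

section \<open>Bijection between hook fillings and pairs of semistandard fillings\<close>

fun letter_index :: "letter \<Rightarrow> nat" where
  "letter_index (Unprimed i) = i"
| "letter_index (Primed i) = i"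

definition unprimed_cells :: "(nat \<times> nat) set \<Rightarrow> (nat \<times> nat \<Rightarrow> letter) \<Rightarrow> (nat \<times> nat) set" where
  "unprimed_cells D T = {c \<in> D. T c \<in> range Unprimed}"

text \<open>\<open>U\<close> lives on transposed cells, hence the swap. The restriction to
  \<open>D\<close> makes the result extensional.\<close>

definition join_fillings ::
    "(nat \<times> nat) set \<Rightarrow> (nat \<times> nat) set \<Rightarrow> (nat \<times> nat \<Rightarrow> nat) \<Rightarrow> (nat \<times> nat \<Rightarrow> nat) \<Rightarrow>
     nat \<times> nat \<Rightarrow> letter" where
  "join_fillings D E T U =
     (\<lambda>c\<in>D. if c \<in> E then Unprimed (T c) else Primed (U (prod.swap c)))"

text \<open>Transposition turns the weak rows and strict columns of \<open>U\<close> into the weak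
  columns and strict rows required of primed letters. In a mixed pair, down-closedness of
  \<open>E\<close> puts the unprimed entry first, and unprimed letters precede primed ones.\<close>

lemma join_fillings_mem:
  assumes E: "E \<subseteq> D"
    and down: "\<And>i j i' j'. (i', j') \<in> E \<Longrightarrow> i \<le> i' \<Longrightarrow> j \<le> j' \<Longrightarrow> (i, j) \<in> E"
    and T: "T \<in> ssyt_on l E" and U: "U \<in> ssyt_on k (prod.swap ` (D - E))"
  shows "join_fillings D E T U \<in> {V \<in> hook_fillings (letters l k) D. unprimed_cells D V = E}"
proof -
  let ?V = "join_fillings D E T U"
  have V: "(i, j) \<in> E \<Longrightarrow> ?V (i, j) = Unprimed (T (i, j))"
    "(i, j) \<in> D - E \<Longrightarrow> ?V (i, j) = Primed (U (j, i))" for i j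
    using E by (auto simp: join_fillings_def)
  have swap: "(j, i) \<in> prod.swap ` (D - E) \<longleftrightarrow> (i, j) \<in> D - E" for i j
    by force
  have T': "(i, j) \<in> E \<Longrightarrow> T (i, j) \<in> {1..l}"
    "(i, j) \<in> E \<Longrightarrow> (i, j') \<in> E \<Longrightarrow> j < j' \<Longrightarrow> T (i, j) \<le> T (i, j')"
    "(i, j) \<in> E \<Longrightarrow> (i', j) \<in> E \<Longrightarrow> i < i' \<Longrightarrow> T (i, j) < T (i', j)" for i i' j j'
    using T unfolding ssyt_on_def by blast+
  have U': "(i, j) \<in> D - E \<Longrightarrow> U (j, i) \<in> {1..k}"
    "(i, j) \<in> D - E \<Longrightarrow> (i, j') \<in> D - E \<Longrightarrow> j < j' \<Longrightarrow> U (j, i) < U (j', i)"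
    "(i, j) \<in> D - E \<Longrightarrow> (i', j) \<in> D - E \<Longrightarrow> i < i' \<Longrightarrow> U (j, i) \<le> U (j, i')" for i i' j j'
    using U unfolding ssyt_on_def swap[symmetric] by blast+
  have entry: "?V (i, j) \<in> letters l k" if "(i, j) \<in> D" for i j
    using V[of i j] T'(1)[of i j] U'(1)[of i j] that
    by (cases "(i, j) \<in> E") (auto simp: letters_def)
  have "?V \<in> D \<rightarrow>\<^sub>E letters l k"
  proof (rule PiE_I)
    show "?V c \<in> letters l k" if "c \<in> D" for c
      using entry[of "fst c" "snd c"] that by simp
  qed (simp add: join_fillings_def)
  moreover have "row_incr (?V (i, j)) (?V (i, j'))" if "(i, j) \<in> D" "(i, j') \<in> D" "j < j'" for i j j'
    using V[of i j] V[of i j'] T'(2)[of i j j'] U'(2)[of i j j'] down[of i j' i j] that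
    by (cases "(i, j) \<in> E"; cases "(i, j') \<in> E") (auto simp: row_incr_def le_less)
  moreover have "col_incr (?V (i, j)) (?V (i', j))" if "(i, j) \<in> D" "(i', j) \<in> D" "i < i'" for i i' j
    using V[of i j] V[of i' j] T'(3)[of i j i'] U'(3)[of i j i'] down[of i' j i j] that
    by (cases "(i, j) \<in> E"; cases "(i', j) \<in> E") (auto simp: col_incr_def le_less)
  moreover have "unprimed_cells D ?V = E"
    using E by (auto simp: unprimed_cells_def join_fillings_def)
  ultimately show ?thesis by (auto simp: hook_fillings_def)
qed

text \<open>Among letters of one kind, \<open>row_incr\<close> and \<open>col_incr\<close> compare
  indices, weakly or strictly. Nothing is lost by forgetting the primes, since membership in
  \<open>E\<close> records them.\<close>

lemma split_fillings_mem:
  assumes V: "V \<in> hook_fillings (letters l k) D" and E: "unprimed_cells D V = E"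
  shows "(\<lambda>c\<in>E. letter_index (V c)) \<in> ssyt_on l E"
    and "(\<lambda>c\<in>prod.swap ` (D - E). letter_index (V (prod.swap c))) \<in> ssyt_on k (prod.swap ` (D - E))"
    and "join_fillings D E (\<lambda>c\<in>E. letter_index (V c))
           (\<lambda>c\<in>prod.swap ` (D - E). letter_index (V (prod.swap c))) = V"
proof -
  have entry: "c \<in> D \<Longrightarrow> V c \<in> letters l k" for c
    using V by (auto simp: hook_fillings_def)
  have mem_E: "c \<in> E \<longleftrightarrow> c \<in> D \<and> V c \<in> range Unprimed" for c
    using E by (auto simp: unprimed_cells_def)
  have inE: "c \<in> E \<Longrightarrow> c \<in> D \<and> (\<exists>a\<in>{1..l}. V c = Unprimed a)" for c
    using entry[of c] mem_E[of c] by (auto simp: letters_def)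
  have notE: "c \<in> D - E \<Longrightarrow> \<exists>a\<in>{1..k}. V c = Primed a" for c
    using entry[of c] mem_E[of c] by (auto simp: letters_def)
  have row: "row_incr (V (i, j)) (V (i, j'))" if "(i, j) \<in> D" "(i, j') \<in> D" "j < j'" for i j j'
    using V that unfolding hook_fillings_def by blast
  have col: "col_incr (V (i, j)) (V (i', j))" if "(i, j) \<in> D" "(i', j) \<in> D" "i < i'" for i i' j
    using V that unfolding hook_fillings_def by blast
  have swap: "(j, i) \<in> prod.swap ` (D - E) \<longleftrightarrow> (i, j) \<in> D - E" for i j
    by force
  show "(\<lambda>c\<in>E. letter_index (V c)) \<in> ssyt_on l E"
  proof -
    have "letter_index (V (i, j)) \<le> letter_index (V (i, j'))"
      if "(i, j) \<in> E" "(i, j') \<in> E" "j < j'" for i j j'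
      using inE[OF that(1)] inE[OF that(2)] row[of i j j'] that(3) by (auto simp: row_incr_def)
    moreover have "letter_index (V (i, j)) < letter_index (V (i', j))"
      if "(i, j) \<in> E" "(i', j) \<in> E" "i < i'" for i i' j
      using inE[OF that(1)] inE[OF that(2)] col[of i j i'] that(3) by (auto simp: col_incr_def)
    moreover have "letter_index (V c) \<in> {1..l}" if "c \<in> E" for c
      using inE[OF that] by auto
    ultimately show ?thesis by (simp add: ssyt_on_def)
  qed
  show "(\<lambda>c\<in>prod.swap ` (D - E). letter_index (V (prod.swap c))) \<in> ssyt_on k (prod.swap ` (D - E))"
  proof -
    have "letter_index (V (i, j)) < letter_index (V (i, j'))"
      if "(i, j) \<in> D - E" "(i, j') \<in> D - E" "j < j'" for i j j'
      using notE[OF that(1)] notE[OF that(2)] row[of i j j'] that by (auto simp: row_incr_def)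
    moreover have "letter_index (V (i, j)) \<le> letter_index (V (i', j))"
      if "(i, j) \<in> D - E" "(i', j) \<in> D - E" "i < i'" for i i' j
      using notE[OF that(1)] notE[OF that(2)] col[of i j i'] that by (auto simp: col_incr_def)
    moreover have "letter_index (V c) \<in> {1..k}" if "c \<in> D - E" for c
      using notE[OF that] by auto
    ultimately show ?thesis by (simp add: ssyt_on_def swap del: Diff_iff) auto
  qed
  show "join_fillings D E (\<lambda>c\<in>E. letter_index (V c))
           (\<lambda>c\<in>prod.swap ` (D - E). letter_index (V (prod.swap c))) = V"
  proof
    fix c
    consider "c \<in> E" | "c \<in> D - E" | "c \<notin> D" by blast
    then show "join_fillings D E (\<lambda>c\<in>E. letter_index (V c))
           (\<lambda>c\<in>prod.swap ` (D - E). letter_index (V (prod.swap c))) c = V c"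
    proof cases
      case 1
      then show ?thesis using inE[OF 1] by (auto simp: join_fillings_def)
    next
      case 2
      then show ?thesis using notE[OF 2] by (auto simp: join_fillings_def)
    next
      case 3
      \<comment> \<open>Outside \<open>D\<close> both sides take the default value
        \<open>undefined\<close>.\<close>
      have "V \<in> D \<rightarrow>\<^sub>E letters l k" using V by (simp add: hook_fillings_def)
      then have "V c = undefined" using 3 by (rule PiE_arb)
      then show ?thesis using 3 by (simp add: join_fillings_def)
    qed
  qed
qed

text \<open>For a fixed set \<open>E\<close> of unprimed cells, joining and splitting are mutually
  inverse, and the monomial factors along \<open>E\<close> and \<open>D - E\<close>.\<close>

lemma sum_split_fillings:
  assumes D: "finite D" and E: "E \<subseteq> D"
    and down: "\<And>i j i' j'. (i', j') \<in> E \<Longrightarrow> i \<le> i' \<Longrightarrow> j \<le> j' \<Longrightarrow> (i, j) \<in> E"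
  shows "(\<Sum>T \<in> ssyt_on l E. \<Prod>c\<in>E. x_var (T c)) *
      (\<Sum>U \<in> ssyt_on k (prod.swap ` (D - E)). \<Prod>c \<in> prod.swap ` (D - E). y_var (U c)) =
    (\<Sum>V | V \<in> hook_fillings (letters l k) D \<and> unprimed_cells D V = E. \<Prod>c\<in>D. z_var (V c))"
proof -
  let ?D' = "prod.swap ` (D - E)"
  have "(\<Sum>T \<in> ssyt_on l E. \<Prod>c\<in>E. x_var (T c)) * (\<Sum>U \<in> ssyt_on k ?D'. \<Prod>c\<in>?D'. y_var (U c)) =
      (\<Sum>(T, U) \<in> ssyt_on l E \<times> ssyt_on k ?D'. (\<Prod>c\<in>E. x_var (T c)) * (\<Prod>c\<in>?D'. y_var (U c)))"
    by (simp add: sum_product sum.cartesian_product)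
  also have "\<dots> = (\<Sum>V | V \<in> hook_fillings (letters l k) D \<and> unprimed_cells D V = E. \<Prod>c\<in>D. z_var (V c))"
  proof (rule sum.reindex_bij_witness[where j = "\<lambda>(T, U). join_fillings D E T U"
        and i = "\<lambda>V. (\<lambda>c\<in>E. letter_index (V c), \<lambda>c\<in>?D'. letter_index (V (prod.swap c)))"])
    fix x assume "x \<in> ssyt_on l E \<times> ssyt_on k ?D'"
    then obtain T U where x: "x = (T, U)" and T: "T \<in> ssyt_on l E" and U: "U \<in> ssyt_on k ?D'"
      by blast
    let ?V = "join_fillings D E T U"
    show "(case x of (T, U) \<Rightarrow> join_fillings D E T U) \<in>
        {V. V \<in> hook_fillings (letters l k) D \<and> unprimed_cells D V = E}"
      using join_fillings_mem[OF E down T U] by (simp add: x)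
    have "(\<lambda>c\<in>E. letter_index (?V c)) = T"
      using T E by (auto simp: fun_eq_iff join_fillings_def ssyt_on_def PiE_def extensional_def)
    moreover have "(\<lambda>c\<in>?D'. letter_index (?V (prod.swap c))) = U"
    proof
      fix c show "(\<lambda>c\<in>?D'. letter_index (?V (prod.swap c))) c = U c"
      proof (cases "c \<in> ?D'")
        case True
        then show ?thesis by (auto simp: join_fillings_def)
      next
        case False
        moreover have "U \<in> ?D' \<rightarrow>\<^sub>E {1..k}" using U by (simp add: ssyt_on_def)
        ultimately show ?thesis by (metis PiE_arb restrict_apply)
      qed
    qed
    ultimately show "(\<lambda>c\<in>E. letter_index ((case x of (T, U) \<Rightarrow> join_fillings D E T U) c),
        \<lambda>c\<in>?D'. letter_index ((case x of (T, U) \<Rightarrow> join_fillings D E T U) (prod.swap c))) = x"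
      by (simp add: x)
    have "(\<Prod>c\<in>D. z_var (?V c)) = (\<Prod>c\<in>D - E. z_var (?V c)) * (\<Prod>c\<in>E. z_var (?V c))"
      by (rule prod.subset_diff[OF E D])
    also have "(\<Prod>c\<in>E. z_var (?V c)) = (\<Prod>c\<in>E. x_var (T c))"
      using E by (intro prod.cong) (auto simp: join_fillings_def x_var_def)
    \<comment> \<open>The product over the transposed cells is pulled back along
      \<open>prod.swap\<close>.\<close>
    also have "(\<Prod>c\<in>D - E. z_var (?V c)) = (\<Prod>c\<in>?D'. y_var (U c))"
      by (subst prod.reindex) (auto simp: join_fillings_def y_var_def intro!: prod.cong)
    finally show "(\<Prod>c\<in>D. z_var ((case x of (T, U) \<Rightarrow> join_fillings D E T U) c)) =
        (case x of (T, U) \<Rightarrow> (\<Prod>c\<in>E. x_var (T c)) * (\<Prod>c\<in>?D'. y_var (U c)))"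
      by (simp add: x mult.commute)
  next
    fix V assume "V \<in> {V. V \<in> hook_fillings (letters l k) D \<and> unprimed_cells D V = E}"
    then have V: "V \<in> hook_fillings (letters l k) D" "unprimed_cells D V = E" by auto
    note split = split_fillings_mem[OF V]
    show "(case (\<lambda>c\<in>E. letter_index (V c), \<lambda>c\<in>?D'. letter_index (V (prod.swap c))) of
        (T, U) \<Rightarrow> join_fillings D E T U) = V"
      using split(3) by simp
    show "(\<lambda>c\<in>E. letter_index (V c), \<lambda>c\<in>?D'. letter_index (V (prod.swap c))) \<in>
        ssyt_on l E \<times> ssyt_on k ?D'"
      using split(1,2) by simp
  qed
  finally show ?thesis .
qed

text \<open>In both relations only an unprimed letter can precede an unprimed one. The path goes
  down column \<open>j'\<close> to row \<open>i\<close>, then left to column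
  \<open>j\<close>.\<close>

lemma unprimed_cells_down_closed:
  assumes p: "is_partition p" and V: "V \<in> hook_fillings A (diagram p)"
    and c: "(i', j') \<in> unprimed_cells (diagram p) V" and le: "i \<le> i'" "j \<le> j'"
  shows "(i, j) \<in> unprimed_cells (diagram p) V"
proof -
  obtain a where a: "V (i', j') = Unprimed a" and D: "(i', j') \<in> diagram p"
    using c by (auto simp: unprimed_cells_def)
  have D': "(i, j') \<in> diagram p" "(i, j) \<in> diagram p"
    using diagram_down_closed[OF p D] le by auto
  have "V (i, j') \<in> range Unprimed"
  proof (cases "i = i'")
    case False
    then have "col_incr (V (i, j')) (V (i', j'))"
      using V D D' le by (auto simp: hook_fillings_def)
    then show ?thesis by (cases "V (i, j')") (auto simp: a col_incr_def)
  qed (simp add: a)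
  then obtain b where b: "V (i, j') = Unprimed b" by auto
  have "V (i, j) \<in> range Unprimed"
  proof (cases "j = j'")
    case False
    then have "row_incr (V (i, j)) (V (i, j'))"
      using V D' le by (auto simp: hook_fillings_def)
    then show ?thesis by (cases "V (i, j)") (auto simp: b row_incr_def)
  qed (simp add: b)
  then show ?thesis using D' by (simp add: unprimed_cells_def)
qed

text \<open>Fillings are grouped by the partition formed by their unprimed cells; each group yields
  one summand of the hook Schur polynomial.\<close>

lemma hook_schur_eq_hook_fillings:
  assumes p: "is_partition p"
  shows "hook_schur l k p =
    (\<Sum>V \<in> hook_fillings (letters l k) (diagram p). \<Prod>c \<in> diagram p. z_var (V c))"
proof -
  let ?H = "hook_fillings (letters l k) (diagram p)"
  let ?w = "\<lambda>V. \<Prod>c \<in> diagram p. z_var (V c)"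
  \<comment> \<open>For fillings in \<open>?H\<close> the unprimed cells are finite and down-closed,
    so such a partition exists; a diagram determines its partition, so it is unique.\<close>
  define shape where
    "shape V = (THE q. is_partition q \<and> diagram q = unprimed_cells (diagram p) V)" for V
  have shape: "shape V = q" if "is_partition q" "diagram q = unprimed_cells (diagram p) V" for V q
    unfolding shape_def by (rule the_equality) (use that diagram_inj in auto)
  have shape_ex: "is_partition (shape V) \<and> diagram (shape V) = unprimed_cells (diagram p) V"
    if "V \<in> ?H" for V
  proof -
    have "finite (unprimed_cells (diagram p) V)"
      using finite_diagram[of p] by (simp add: unprimed_cells_def)
    then have "\<exists>q. is_partition q \<and> diagram q = unprimed_cells (diagram p) V"
      by (rule ex_partition_diagram) (rule unprimed_cells_down_closed[OF p that])
    then show ?thesis using shape by metis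
  qed
  have "finite ?H"
    by (rule finite_subset[of _ "diagram p \<rightarrow>\<^sub>E letters l k"])
      (auto simp: hook_fillings_def finite_PiE finite_diagram finite_letters)
  moreover have "shape ` ?H \<subseteq> subpartitions p"
    using shape_ex by (auto simp: subpartitions_def unprimed_cells_def)
  ultimately have "sum ?w ?H = (\<Sum>q \<in> subpartitions p. \<Sum>V | V \<in> ?H \<and> shape V = q. ?w V)"
    by (simp add: sum.group finite_subpartitions)
  also have "\<dots> = (\<Sum>q \<in> subpartitions p.
      schur l x_var q * skew_schur k y_var (conjugate p) (conjugate q))"
  proof (rule sum.cong[OF refl])
    fix q assume "q \<in> subpartitions p"
    then have q: "is_partition q" "diagram q \<subseteq> diagram p" by (auto simp: subpartitions_def)
    have "{V. V \<in> ?H \<and> shape V = q} = {V. V \<in> ?H \<and> unprimed_cells (diagram p) V = diagram q}"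
      using shape[OF q(1)] shape_ex by auto
    \<comment> \<open>Conjugating both partitions transposes the skew diagram.\<close>
    moreover have "diagram (conjugate p) - diagram (conjugate q) =
        prod.swap ` (diagram p - diagram q)"
      using mem_diagram_conjugate[OF p] mem_diagram_conjugate[OF q(1)] by force
    moreover have "diagram [] = {}" by (simp add: diagram_def)
    ultimately show "(\<Sum>V | V \<in> ?H \<and> shape V = q. ?w V) =
        schur l x_var q * skew_schur k y_var (conjugate p) (conjugate q)"
      using sum_split_fillings[OF finite_diagram q(2) diagram_down_closed[OF q(1)], where l = l and k = k]
      by (simp add: schur_def skew_schur_eq)
  qed
  finally show ?thesis by (simp add: hook_schur_def)
qed

theorem theorem5p8:
  fixes l k :: nat and p :: "nat list"
  assumes "is_partition p"
  shows "hook_schur l k p =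
    (\<Sum>\<tau> | \<tau> permutes {..<length p}.
       of_int (sign \<tau>) * hook_dual_immaculate_opt l k (perm_shape \<tau> p))"
  using assms by (simp only: hook_schur_eq_hook_fillings sum_perm_fillings_eq_hook_fillings)

end
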